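(* Let $A,\hat A\in\mathbb{C}^{n\times n}$ be strictly positive-definite matrices with Kaporin condition number $\kappa_{\rm Kap}$. If $\hat A$ is normalized so that $\operatorname{tr}(A\hat A^{-1})=n$, then $$\log\left(\frac{\det\hat A}{\det A}\right)=\log(\kappa_{\rm Kap}).$$
   Context: For strictly positive-definite (Hermitian) $A,\hat A\in\mathbb{C}^{n\times n}$, the Kaporin condition number is $$\kappa_{\rm Kap}=\frac{\bigl(\frac1n\operatorname{tr}(A\hat A^{-1})\bigr)^n}{\det(A\hat A^{-1})}.$$ (In general, for positive-semidefinite matrices of the same range and $r=\operatorname{rank}(A)$, it is $(\frac1r\operatorname{tr}(A\hat A^+))^r/\operatorname{vol}(A\hat A^+)$, where $\operatorname{vol}$ is the product of the positive eigenvalues and $^+$ the Moore–Penrose pseudoinverse.) *)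

theory Defs
  imports "HOL-Analysis.Analysis"
begin

definition conj_transpose :: "complex^'n^'m \<Rightarrow> complex^'m^'n" where
  "conj_transpose A = (\<chi> i j. cnj (A $ j $ i))"

definition hermitian :: "complex^'n^'n \<Rightarrow> bool" where
  "hermitian A \<longleftrightarrow> conj_transpose A = A"

(* The sum is x^* A x, a real number because A is Hermitian. *)
definition positive_definite :: "complex^'n^'n \<Rightarrow> bool" where
  "positive_definite A \<longleftrightarrow>
     hermitian A \<and> (\<forall>x. x \<noteq> 0 \<longrightarrow> 0 < Re (\<Sum>i\<in>UNIV. cnj (x $ i) * (A *v x) $ i))"

(* For positive definite A and A', the trace and the determinant of A ** matrix_inv A' are
   real and the determinant is positive, so Re discards nothing: see the lemmas
   positive_definite_det, trace_mul_inv_real and det_mul_inv_real_pos below. *)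
definition kaporin :: "complex^'n^'n \<Rightarrow> complex^'n^'n \<Rightarrow> real" where
  "kaporin A A' =
     (Re (trace (A ** matrix_inv A')) / real CARD('n)) ^ CARD('n) / Re (det (A ** matrix_inv A'))"

lemma conj_transpose_mult: "conj_transpose (A ** B) = conj_transpose B ** conj_transpose A"
  by (simp add: conj_transpose_def matrix_matrix_mult_def vec_eq_iff mult.commute)

lemma conj_transpose_mat_1: "conj_transpose (mat 1) = mat 1"
  by (simp add: conj_transpose_def mat_def vec_eq_iff)

lemma det_conj_transpose: "det (conj_transpose A) = cnj (det A)"
proof -
  have "det (conj_transpose A) = det (\<chi> i j. cnj (A $ i $ j))"
    by (subst det_transpose[symmetric]) (simp add: conj_transpose_def transpose_def)
  also have "\<dots> = cnj (det A)"
    by (simp add: det_def)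
  finally show ?thesis .
qed

lemma trace_conj_transpose: "trace (conj_transpose A) = cnj (trace A)"
  by (simp add: trace_def conj_transpose_def)

lemma hermitian_det_real:
  assumes "hermitian A" shows "det A \<in> \<real>"
  using assms det_conj_transpose[of A] by (simp add: hermitian_def complex_is_Real_iff complex_eq_iff)

lemma positive_definite_det_nz:
  assumes "positive_definite A" shows "det A \<noteq> 0"
proof
  assume "det A = 0"
  then obtain x where "x \<noteq> 0" "A *v x = 0"
    using invertible_det_nz[of A] invertible_left_inverse[of A] matrix_left_invertible_ker[of A]
    by blast
  then show False
    using assms by (auto simp: positive_definite_def)
qed

lemma positive_definite_det:
  fixes A :: "complex^'n^'n"
  assumes "positive_definite A" shows "det A \<in> \<real>" "0 < Re (det A)"
proof -
  show "det A \<in> \<real>"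
    using assms hermitian_det_real positive_definite_def by blast
  define M :: "real \<Rightarrow> complex^'n^'n"
    where "M t = (\<chi> i j. of_real (1 - t) * mat 1 $ i $ j + of_real t * A $ i $ j)" for t
  have pd: "positive_definite (M t)" if "0 \<le> t" "t \<le> 1" for t
    unfolding positive_definite_def
  proof (intro conjI allI impI)
    have A: "cnj (A $ j $ i) = A $ i $ j" for i j
      using assms by (auto simp: positive_definite_def hermitian_def conj_transpose_def vec_eq_iff)
    show "hermitian (M t)"
      by (auto simp: hermitian_def conj_transpose_def M_def vec_eq_iff A mat_def)
    fix x :: "complex^'n" assume x: "x \<noteq> 0"
    have Mx: "(M t *v x) $ i = of_real (1 - t) * x $ i + of_real t * (A *v x) $ i" for i
      by (simp add: M_def matrix_vector_mult_def mat_def ring_distribs sum.distrib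
          sum_distrib_left mult.assoc if_distrib[of "\<lambda>c. c * _"] cong: if_cong)
        (simp add: algebra_simps sum_subtractf if_distrib cong: if_cong)
    define q where "q = (\<Sum>i\<in>UNIV. Re (cnj (x $ i) * (A *v x) $ i))"
    define p where "p = (\<Sum>i\<in>UNIV. (norm (x $ i))\<^sup>2)"
    have q: "0 < q"
      using assms x unfolding positive_definite_def q_def Re_sum by blast
    have p: "0 < p"
    proof -
      obtain i where "x $ i \<noteq> 0" using x by (auto simp: vec_eq_iff)
      then show ?thesis
        unfolding p_def by (intro sum_pos2[of _ i]) auto
    qed
    have "Re (cnj (x $ i) * (M t *v x) $ i)
        = (1 - t) * (norm (x $ i))\<^sup>2 + t * Re (cnj (x $ i) * (A *v x) $ i)" for i
      unfolding cmod_power2 by (simp add: Mx algebra_simps power2_eq_square)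
    then have "Re (\<Sum>i\<in>UNIV. cnj (x $ i) * (M t *v x) $ i) = (1 - t) * p + t * q"
      by (simp only: Re_sum p_def q_def sum.distrib sum_distrib_left)
    moreover have "0 < (1 - t) * p + t * q"
      using that p q by (cases "t = 0") (auto intro: add_nonneg_pos)
    ultimately show "0 < Re (\<Sum>i\<in>UNIV. cnj (x $ i) * (M t *v x) $ i)" by simp
  qed
  have nz: "Re (det (M t)) \<noteq> 0" if "0 \<le> t" "t \<le> 1" for t
    using positive_definite_det_nz[OF pd[OF that]] hermitian_det_real[of "M t"] pd[OF that]
    by (auto simp: positive_definite_def complex_is_Real_iff complex_eq_iff)
  have M0: "M 0 = mat 1" and M1: "M 1 = A"
    by (simp_all add: M_def vec_eq_iff)
  have cont: "continuous_on {0..1} (\<lambda>t. Re (det (M t)))"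
    unfolding det_def M_def by (simp del: Re_sum) (intro continuous_intros)
  show "0 < Re (det A)"
  proof (rule ccontr)
    assume "\<not> 0 < Re (det A)"
    then have "\<exists>t\<ge>0. t \<le> 1 \<and> Re (det (M t)) = 0"
      using cont by (intro IVT2') (auto simp: M0 M1)
    then show False using nz by blast
  qed
qed

lemma matrix_inv_positive_definite:
  assumes "positive_definite A"
  shows "A ** matrix_inv A = mat 1" "matrix_inv A ** A = mat 1"
proof -
  have "invertible A"
    using positive_definite_det_nz[OF assms] invertible_det_nz by blast
  then have "A ** matrix_inv A = mat 1 \<and> matrix_inv A ** A = mat 1"
    unfolding invertible_def matrix_inv_def by (rule someI_ex)
  then show "A ** matrix_inv A = mat 1" "matrix_inv A ** A = mat 1" by auto
qed

lemma hermitian_matrix_inv: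
  assumes "positive_definite A" shows "hermitian (matrix_inv A)"
proof -
  note inv = matrix_inv_positive_definite[OF assms]
  let ?B = "conj_transpose (matrix_inv A)"
  have "?B ** A = mat 1"
    using arg_cong[OF inv(1), of conj_transpose] assms
    by (simp add: conj_transpose_mult conj_transpose_mat_1 positive_definite_def hermitian_def)
  then have "?B = matrix_inv A"
    by (metis inv(1) matrix_mul_assoc matrix_mul_lid matrix_mul_rid)
  then show ?thesis by (simp add: hermitian_def)
qed

lemma trace_mul_inv_real:
  assumes "positive_definite A" "positive_definite A'"
  shows "trace (A ** matrix_inv A') \<in> \<real>"
proof -
  have "cnj (trace (A ** matrix_inv A')) = trace (matrix_inv A' ** A)"
    using assms hermitian_matrix_inv[OF assms(2)]
    by (simp flip: trace_conj_transpose
        add: conj_transpose_mult hermitian_def positive_definite_def)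
  also have "\<dots> = trace (A ** matrix_inv A')"
    by (rule trace_mul_sym)
  finally show ?thesis
    by (simp add: Reals_cnj_iff)
qed

lemma det_mul_inv_real_pos:
  assumes "positive_definite A" "positive_definite A'"
  shows "det (A ** matrix_inv A') \<in> \<real>" "0 < Re (det (A ** matrix_inv A'))"
proof -
  have "det A' * det (matrix_inv A') = 1"
    using arg_cong[OF matrix_inv_positive_definite(1)[OF assms(2)], of det] by (simp add: det_mul)
  then have eq: "det (A ** matrix_inv A') = det A / det A'"
    using positive_definite_det_nz[OF assms(2)] by (simp add: det_mul field_simps)
  obtain a b where "det A = of_real a" "det A' = of_real b"
    using positive_definite_det(1) assms by (metis Reals_cases)
  then show "det (A ** matrix_inv A') \<in> \<real>" "0 < Re (det (A ** matrix_inv A'))"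
    using positive_definite_det(2)[OF assms(1)] positive_definite_det(2)[OF assms(2)]
    by (simp_all add: eq flip: of_real_divide)
qed

end

theory Submission
  imports Defs
begin

text \<open>
  The normalization makes the numerator of the Kaporin condition number equal to
  \<open>1 ^ n = 1\<close>, so only the reciprocal of \<open>det (A ** matrix_inv A')\<close> is left. By multiplicativity
  of the determinant this reciprocal is \<open>det A' / det A\<close>. Both determinants are real, so taking
  real parts commutes with forming the quotient, and the two arguments of the logarithm agree.
\<close>

lemma det_mul_matrix_inv:
  fixes A A' :: "complex^'n^'n"
  assumes "positive_definite A'"
  shows "det (A ** matrix_inv A') = det A / det A'"
proof -
  have "det A' * det (matrix_inv A') = 1"
    using arg_cong[OF matrix_inv_positive_definite(1)[OF assms], of det] by (simp add: det_mul)
  then show ?thesis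
    using positive_definite_det_nz[OF assms] by (simp add: det_mul field_simps)
qed

theorem proposition3p4:
  fixes A A' :: "complex^'n^'n"
  assumes "positive_definite A" and "positive_definite A'"
    and "trace (A ** matrix_inv A') = of_nat CARD('n)"
  shows "ln (Re (det A') / Re (det A)) = ln (kaporin A A')"
proof -
  obtain a b where ab: "det A = of_real a" "det A' = of_real b"
    using positive_definite_det(1) assms(1,2) by (metis Reals_cases)
  have "Re (det (A ** matrix_inv A')) = a / b"
    by (simp add: det_mul_matrix_inv[OF assms(2)] ab flip: of_real_divide)
  then have "kaporin A A' = b / a"
    by (simp add: kaporin_def assms(3))
  then show ?thesis
    by (simp add: ab)
qed

end
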